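(* Let $p$ be a prime, let $n, D$ be nonnegative integers with $n\ge1$, and let $m, n_1,\dots,n_m$ be positive integers such that $n_1+\cdots+n_m\ge D$. Let $A_1,\dots,A_m\subseteq \mathbb{F}_p^n$ be sets such that for each $1\le i\le m$, $A_i$ is not contained in the zero set of any nonzero polynomial in $\mathbb{F}_p[X_1,\dots,X_n]$ of degree $\le n_i$. Then \[ |A_1+\cdots+A_m|\ge N(p,n,D). \]
   Context: $N(q,n,D)$ denotes the number of monomials $X_1^{\alpha_1}\cdots X_n^{\alpha_n}$ in $n$ variables of total degree $\alpha_1+\cdots+\alpha_n\le D$ with $\alpha_j\le q-1$ for every $j$. For sets $A_1,\dots,A_m$ in an abelian group, $A_1+\cdots+A_m=\{a_1+\cdots+a_m : a_i\in A_i\}$. *)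

theory Defs
  imports
    "HOL-Analysis.Finite_Cartesian_Product"
    "HOL-Library.Poly_Mapping"
    "HOL-Library.Set_Algebras"
    "Berlekamp_Zassenhaus.Finite_Field"
begin

text \<open>
  A monomial with variables indexed by \<open>'v\<close> is its finitely supported exponent
  function; a polynomial is the finitely supported function sending each monomial
  to its coefficient.  Polynomials are thus formal: over a finite field, a nonzero
  polynomial may vanish at every point.
\<close>

type_synonym 'v monomial = "'v \<Rightarrow>\<^sub>0 nat"

type_synonym ('v, 'a) mpoly = "'v monomial \<Rightarrow>\<^sub>0 'a"

definition monomial_degree :: "'v monomial \<Rightarrow> nat" where
  "monomial_degree \<alpha> = (\<Sum>j\<in>Poly_Mapping.keys \<alpha>. Poly_Mapping.lookup \<alpha> j)"

text \<open>The zero polynomial gets degree 0.\<close>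

definition total_degree :: "('v, 'a::zero) mpoly \<Rightarrow> nat" where
  "total_degree P = Max (insert 0 (monomial_degree ` Poly_Mapping.keys P))"

definition mpoly_eval :: "('n::finite, 'a::comm_semiring_1) mpoly \<Rightarrow> 'a ^ 'n \<Rightarrow> 'a" where
  "mpoly_eval P x =
     (\<Sum>\<alpha>\<in>Poly_Mapping.keys P.
        Poly_Mapping.lookup P \<alpha> * (\<Prod>j\<in>UNIV. (x $ j) ^ Poly_Mapping.lookup \<alpha> j))"

definition zero_set :: "('n::finite, 'a::comm_semiring_1) mpoly \<Rightarrow> ('a ^ 'n) set" where
  "zero_set P = {x. mpoly_eval P x = 0}"

definition num_monomials :: "nat \<Rightarrow> nat \<Rightarrow> nat \<Rightarrow> nat" where
  "num_monomials q n D =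
     card {\<alpha> :: nat monomial. Poly_Mapping.keys \<alpha> \<subseteq> {1..n} \<and> monomial_degree \<alpha> \<le> D \<and>
       (\<forall>j\<in>{1..n}. Poly_Mapping.lookup \<alpha> j \<le> q - 1)}"

end

theory Submission
  imports Defs
begin

text \<open>
  A polynomial whose exponents are all below \<open>p\<close> is called reduced.  If no nonzero reduced
  polynomial of degree at most \<open>a\<close> (resp. \<open>b\<close>) vanishes on \<open>A\<close> (resp. \<open>B\<close>), then none of degree
  at most \<open>a + b\<close> vanishes on \<open>A + B\<close>.  Indeed, let \<open>P\<close> be reduced of degree \<open>d = a' + b'\<close> with
  \<open>a' \<le> a\<close>, \<open>b' \<le> b\<close>, and split an exponent of a leading term as \<open>\<gamma> = \<alpha> + \<beta>\<close> with \<open>|\<alpha>| = a'\<close> and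
  \<open>|\<beta>| = b'\<close>.  By linear duality some combination of evaluations at points of \<open>A\<close> extracts the
  coefficient of \<open>x\<^sup>\<alpha>\<close> from every reduced polynomial of degree at most \<open>a'\<close>, and likewise for \<open>B\<close>
  and \<open>y\<^sup>\<beta>\<close>.  Applied to \<open>P(x + y)\<close>, their product kills every term of \<open>x\<close>-degree below \<open>a'\<close> or
  \<open>y\<close>-degree below \<open>b'\<close>, so what survives is the coefficient of \<open>P\<close> at \<open>\<gamma>\<close> times a product of
  binomial coefficients that are nonzero modulo \<open>p\<close>.  Hence \<open>P\<close> does not vanish on \<open>A + B\<close>.
  For the sum of all \<open>A\<^sub>i\<close>, the monomials counted by \<open>N(p, n, D)\<close> are therefore linearly
  independent as functions on it.
\<close>

section \<open>Independent families of functions, dual functionals and a cardinality bound\<close>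

definition reduced_exponents :: "nat \<Rightarrow> nat \<Rightarrow> ('n::finite \<Rightarrow> nat) set" where
  "reduced_exponents q d = {\<alpha>. (\<forall>j. \<alpha> j < q) \<and> (\<Sum>j\<in>UNIV. \<alpha> j) \<le> d}"

definition monomial_eval :: "('n::finite \<Rightarrow> nat) \<Rightarrow> 'a::comm_semiring_1 ^ 'n \<Rightarrow> 'a" where
  "monomial_eval \<alpha> x = (\<Prod>j\<in>UNIV. (x $ j) ^ \<alpha> j)"

text \<open>Independence of an indexed family of restrictions to \<open>X\<close>: over a field, two
  indices with the same function on \<open>X\<close> make it dependent.\<close>

definition independent_on :: "('i \<Rightarrow> 'x \<Rightarrow> 'a::comm_semiring_1) \<Rightarrow> 'i set \<Rightarrow> 'x set \<Rightarrow> bool" where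
  "independent_on v S X \<longleftrightarrow>
     (\<forall>c. (\<forall>x\<in>X. (\<Sum>s\<in>S. c s * v s x) = 0) \<longrightarrow> (\<forall>s\<in>S. c s = 0))"

lemma independent_onD:
  assumes "independent_on v S X" "\<And>x. x \<in> X \<Longrightarrow> (\<Sum>s\<in>S. c s * v s x) = 0" "s \<in> S"
  shows "c s = 0"
  using assms unfolding independent_on_def by blast

lemma independent_on_subset:
  assumes "independent_on v S X" "T \<subseteq> S" "finite S"
  shows "independent_on v T X"
  unfolding independent_on_def
proof (intro allI impI ballI)
  fix c t
  assume c: "\<forall>x\<in>X. (\<Sum>s\<in>T. c s * v s x) = 0" and t: "t \<in> T"
  have "(\<Sum>s\<in>S. (if s \<in> T then c s else 0) * v s x) = 0" if "x \<in> X" for x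
  proof -
    have "(\<Sum>s\<in>S. (if s \<in> T then c s else 0) * v s x) = (\<Sum>s\<in>T. c s * v s x)"
      using assms(2,3) by (intro sum.mono_neutral_cong_right) auto
    then show ?thesis using c that by simp
  qed
  from independent_onD[OF assms(1) this, where s=t] show "c t = 0"
    using t assms(2) by auto
qed

text \<open>Induction on \<open>S\<close>: a dual system for \<open>S\<close> yields a functional
  for the new index \<open>r\<close>, and the old functionals are then corrected to kill
  \<open>v r\<close>.\<close>

lemma independent_on_dual:
  fixes v :: "'i \<Rightarrow> 'x \<Rightarrow> 'a::field"
  assumes "finite S" "finite X" "independent_on v S X"
  shows "\<exists>\<mu>. \<forall>s\<in>S. \<forall>t\<in>S. (\<Sum>x\<in>X. \<mu> s x * v t x) = (if s = t then 1 else 0)"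
  using assms(1,3)
proof (induction S rule: finite_induct)
  case empty
  then show ?case by simp
next
  case (insert r S)
  have "independent_on v S X"
    by (rule independent_on_subset[OF insert.prems]) (use insert.hyps in auto)
  then obtain \<mu> where \<mu>:
    "\<And>s t. s \<in> S \<Longrightarrow> t \<in> S \<Longrightarrow> (\<Sum>x\<in>X. \<mu> s x * v t x) = (if s = t then 1 else 0)"
    using insert.IH by blast
  define e where "e s = (\<Sum>x\<in>X. \<mu> s x * v r x)" for s
  \<comment> \<open>\<open>w\<close> is \<open>v r\<close> minus its component in the span of
    \<open>S\<close>; every functional \<open>\<mu> s\<close> with \<open>s\<close> in
    \<open>S\<close> kills it.\<close>
  define w where "w x = v r x - (\<Sum>s\<in>S. e s * v s x)" for x
  have "\<exists>z\<in>X. w z \<noteq> 0"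
  proof (rule ccontr)
    assume "\<not> (\<exists>z\<in>X. w z \<noteq> 0)"
    then have w0: "\<And>z. z \<in> X \<Longrightarrow> w z = 0" by blast
    define c where "c s = (if s = r then 1 else - e s)" for s
    have "(\<Sum>s\<in>insert r S. c s * v s x) = 0" if "x \<in> X" for x
    proof -
      have "(\<Sum>s\<in>S. c s * v s x) = (\<Sum>s\<in>S. - (e s * v s x))"
        by (rule sum.cong) (use insert.hyps in \<open>auto simp: c_def\<close>)
      then show ?thesis
        using w0[OF that] insert.hyps by (simp add: w_def c_def sum_negf)
    qed
    from independent_onD[OF insert.prems this, of r] show False
      by (simp add: c_def)
  qed
  then obtain z where z: "z \<in> X" "w z \<noteq> 0" by blast
  \<comment> \<open>Evaluation at \<open>z\<close>, corrected to kill every \<open>v s\<close> with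
    \<open>s\<close> in \<open>S\<close>. Its value on \<open>v r\<close> is then
    \<open>w z\<close>, hence the division.\<close>
  define \<delta> where "\<delta> x = ((if x = z then 1 else 0) - (\<Sum>s\<in>S. v s z * \<mu> s x)) / w z" for x
  have pair: "(\<Sum>x\<in>X. \<delta> x * f x) = (f z - (\<Sum>s\<in>S. v s z * (\<Sum>x\<in>X. \<mu> s x * f x))) / w z" for f
  proof -
    have "(\<Sum>x\<in>X. \<delta> x * f x)
        = (\<Sum>x\<in>X. (if x = z then f x else 0) - (\<Sum>s\<in>S. v s z * (\<mu> s x * f x))) / w z"
      unfolding sum_divide_distrib \<delta>_def
      by (rule sum.cong) (auto simp: algebra_simps sum_distrib_left sum_distrib_right diff_divide_distrib)
    also have "\<dots> = (f z - (\<Sum>x\<in>X. \<Sum>s\<in>S. v s z * (\<mu> s x * f x))) / w z"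
      using z(1) assms(2) by (simp add: sum_subtractf)
    also have "\<dots> = (f z - (\<Sum>s\<in>S. v s z * (\<Sum>x\<in>X. \<mu> s x * f x))) / w z"
      by (subst sum.swap) (simp add: sum_distrib_left)
    finally show ?thesis .
  qed
  have \<delta>S: "(\<Sum>x\<in>X. \<delta> x * v t x) = 0" if "t \<in> S" for t
  proof -
    have "(\<Sum>s\<in>S. v s z * (\<Sum>x\<in>X. \<mu> s x * v t x)) = (\<Sum>s\<in>S. if s = t then v s z else 0)"
      by (rule sum.cong) (use \<mu> that in auto)
    then show ?thesis using that insert.hyps by (simp add: pair)
  qed
  have \<delta>r: "(\<Sum>x\<in>X. \<delta> x * v r x) = 1"
    using z(2) by (simp add: pair w_def e_def mult.commute)
  define \<nu> where "\<nu> s x = (if s = r then \<delta> x else \<mu> s x - e s * \<delta> x)" for s x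
  have "(\<Sum>x\<in>X. \<nu> s x * v t x) = (if s = t then 1 else 0)"
    if st: "s \<in> insert r S" "t \<in> insert r S" for s t
  proof (cases "s = r")
    case True
    then show ?thesis using st \<delta>S \<delta>r insert.hyps by (auto simp: \<nu>_def)
  next
    case False
    then have "(\<Sum>x\<in>X. \<nu> s x * v t x)
        = (\<Sum>x\<in>X. \<mu> s x * v t x) - e s * (\<Sum>x\<in>X. \<delta> x * v t x)"
      by (simp add: \<nu>_def algebra_simps sum_subtractf sum_distrib_left)
    then show ?thesis
      using False st \<mu> \<delta>S \<delta>r insert.hyps by (auto simp: e_def)
  qed
  then show ?case by blast
qed

text \<open>Counting replaces dimension: over a finite field, independence makes evaluation on
  \<open>X\<close> injective on coefficient vectors, and the two function spaces have sizes that are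
  powers of the same base.\<close>

lemma independent_on_card_le:
  fixes v :: "'i \<Rightarrow> 'x \<Rightarrow> 'a::{field, finite}"
  assumes "finite S" "finite X" "independent_on v S X"
  shows "card S \<le> card X"
proof -
  define E where "E c = restrict (\<lambda>x. \<Sum>s\<in>S. c s * v s x) X" for c
  have "inj_on E (S \<rightarrow>\<^sub>E UNIV)"
  proof (rule inj_onI)
    fix c d assume cd: "c \<in> S \<rightarrow>\<^sub>E UNIV" "d \<in> S \<rightarrow>\<^sub>E UNIV" and eq: "E c = E d"
    have "(\<Sum>s\<in>S. (c s - d s) * v s x) = 0" if "x \<in> X" for x
      using fun_cong[OF eq, of x] that by (simp add: E_def algebra_simps sum_subtractf)
    from independent_onD[OF assms(3) this] have "c s = d s" if "s \<in> S" for s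
      using that by fastforce
    then show "c = d" using cd by (intro PiE_ext)
  qed
  moreover have "E ` (S \<rightarrow>\<^sub>E UNIV) \<subseteq> X \<rightarrow>\<^sub>E UNIV"
    by (auto simp: E_def)
  ultimately have "card (S \<rightarrow>\<^sub>E (UNIV::'a set)) \<le> card (X \<rightarrow>\<^sub>E (UNIV::'a set))"
    using assms by (intro card_inj_on_le) (auto intro: finite_PiE)
  then have "CARD('a) ^ card S \<le> CARD('a) ^ card X"
    using assms by (simp add: card_PiE)
  moreover have "CARD('a) > 1"
  proof -
    have "card {0, 1 :: 'a} \<le> CARD('a)" by (intro card_mono) auto
    then show ?thesis by simp
  qed
  ultimately show ?thesis by (rule power_le_imp_le_exp[rotated])
qed

section \<open>Reduced exponents and the expansion of a monomial at a sum\<close>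

lemma finite_reduced_exponents: "finite (reduced_exponents q d)"
proof (rule finite_subset)
  show "reduced_exponents q d \<subseteq> UNIV \<rightarrow>\<^sub>E {..<q}"
    by (auto simp: reduced_exponents_def)
qed (auto intro: finite_PiE)

lemma reduced_exponents_mono: "d \<le> e \<Longrightarrow> reduced_exponents q d \<subseteq> reduced_exponents q e"
  by (auto simp: reduced_exponents_def)

lemma finite_atMost_fun: "finite {..(\<gamma> :: 'n::finite \<Rightarrow> nat)}"
proof (rule finite_subset)
  show "{..\<gamma>} \<subseteq> (\<Pi>\<^sub>E j\<in>UNIV. {..\<gamma> j})"
    by (auto simp: le_fun_def)
qed (auto intro: finite_PiE)

text \<open>Binomial theorem in each coordinate: picking one term per coordinate amounts to picking
  an exponent \<open>\<alpha>\<close> below \<open>\<gamma>\<close> in the pointwise order.\<close>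

lemma monomial_eval_add:
  "monomial_eval \<gamma> (x + y) =
     (\<Sum>\<alpha>\<le>\<gamma>. of_nat (\<Prod>j\<in>UNIV. \<gamma> j choose \<alpha> j) * monomial_eval \<alpha> x * monomial_eval (\<gamma> - \<alpha>) y)"
proof -
  have "(\<Pi>\<^sub>E j\<in>UNIV. {..\<gamma> j}) = {..\<gamma>}"
    by (auto simp: PiE_UNIV_domain le_fun_def Pi_iff)
  then have "monomial_eval \<gamma> (x + y) =
      (\<Sum>\<alpha>\<le>\<gamma>. \<Prod>j\<in>UNIV. of_nat (\<gamma> j choose \<alpha> j) * (x $ j) ^ \<alpha> j * (y $ j) ^ (\<gamma> j - \<alpha> j))"
    by (simp add: monomial_eval_def binomial_ring prod_sum_PiE)
  then show ?thesis
    by (simp add: monomial_eval_def prod.distrib)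
qed

text \<open>Raise one coordinate at a time. This splits a leading exponent into parts of prescribed
  degrees.\<close>

lemma exists_le_fun_sum_eq:
  fixes \<gamma> :: "'n \<Rightarrow> nat"
  assumes "finite J" "a \<le> sum \<gamma> J"
  shows "\<exists>\<alpha>\<le>\<gamma>. sum \<alpha> J = a"
  using assms(2)
proof (induction a)
  case 0
  then show ?case by (intro exI[of _ "\<lambda>_. 0"]) (auto simp: le_fun_def)
next
  case (Suc a)
  then obtain \<alpha> where \<alpha>: "\<alpha> \<le> \<gamma>" "sum \<alpha> J = a" by auto
  have "\<exists>j\<in>J. \<alpha> j < \<gamma> j"
  proof (rule ccontr)
    assume "\<not> ?thesis"
    then have "sum \<gamma> J \<le> sum \<alpha> J" by (intro sum_mono) auto
    then show False using \<alpha> Suc.prems by simp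
  qed
  then obtain j where j: "j \<in> J" "\<alpha> j < \<gamma> j" by blast
  have "sum (\<alpha>(j := Suc (\<alpha> j))) J = Suc (sum \<alpha> J)"
    using j(1) assms(1) by (simp add: sum.remove[of J j])
  then show ?case
    using \<alpha> j by (intro exI[of _ "\<alpha>(j := Suc (\<alpha> j))"]) (auto simp: le_fun_def)
qed

text \<open>Each binomial coefficient divides the factorial of some \<open>\<gamma> j\<close> below
  the prime, so the prime does not divide it.\<close>

lemma of_nat_prod_choose_neq_0:
  fixes \<gamma> \<alpha> :: "'n::finite \<Rightarrow> nat"
  assumes "\<alpha> \<le> \<gamma>" "\<And>j. \<gamma> j < CARD('p)"
  shows "of_nat (\<Prod>j\<in>UNIV. \<gamma> j choose \<alpha> j) \<noteq> (0 :: 'p::prime_card mod_ring)"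
proof -
  have p: "prime CARD('p)" by (rule prime_card)
  have "\<not> CARD('p) dvd (\<gamma> j choose \<alpha> j)" for j
  proof
    assume "CARD('p) dvd (\<gamma> j choose \<alpha> j)"
    then have "CARD('p) dvd fact (\<gamma> j)"
      using binomial_fact_lemma[of "\<alpha> j" "\<gamma> j"] assms(1) by (metis dvd_mult le_funD)
    then show False
      using p assms(2)[of j] by (simp add: prime_dvd_fact_iff)
  qed
  then have "\<not> CARD('p) dvd (\<Prod>j\<in>UNIV. \<gamma> j choose \<alpha> j)"
    using p by (simp add: prime_dvd_prod_iff)
  then show ?thesis
    using of_nat_0_mod_ring_dvd by blast
qed

section \<open>Independence on a sumset of two sets\<close>

lemma independent_on_sumset:
  fixes A B :: "('p::prime_card mod_ring ^ 'n) set"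
  assumes A: "independent_on monomial_eval (reduced_exponents CARD('p) a) A"
    and B: "independent_on monomial_eval (reduced_exponents CARD('p) b) B"
  shows "independent_on monomial_eval (reduced_exponents CARD('p) (a + b)) (A + B)"
  unfolding independent_on_def
proof (intro allI impI, rule ccontr)
  let ?R = "reduced_exponents CARD('p) :: nat \<Rightarrow> ('n \<Rightarrow> nat) set"
  let ?deg = "\<lambda>\<alpha> :: 'n \<Rightarrow> nat. \<Sum>j\<in>UNIV. \<alpha> j"
  fix c :: "('n \<Rightarrow> nat) \<Rightarrow> 'p mod_ring"
  assume c: "\<forall>x\<in>A + B. (\<Sum>\<gamma>\<in>?R (a + b). c \<gamma> * monomial_eval \<gamma> x) = 0"
  assume "\<not> (\<forall>\<gamma>\<in>?R (a + b). c \<gamma> = 0)"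
  then obtain \<gamma>\<^sub>0 where "\<gamma>\<^sub>0 \<in> ?R (a + b) \<and> c \<gamma>\<^sub>0 \<noteq> 0" by blast
  moreover have "\<forall>\<gamma>. \<gamma> \<in> ?R (a + b) \<and> c \<gamma> \<noteq> 0 \<longrightarrow> ?deg \<gamma> < Suc (a + b)"
    by (auto simp: reduced_exponents_def)
  ultimately have "\<exists>\<gamma>. (\<gamma> \<in> ?R (a + b) \<and> c \<gamma> \<noteq> 0) \<and>
      (\<forall>\<gamma>'. \<gamma>' \<in> ?R (a + b) \<and> c \<gamma>' \<noteq> 0 \<longrightarrow> ?deg \<gamma>' \<le> ?deg \<gamma>)"
    by (rule ex_has_greatest_nat)
  then obtain \<gamma> where \<gamma>: "\<gamma> \<in> ?R (a + b)" "c \<gamma> \<noteq> 0"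
    and max: "\<And>\<gamma>'. \<gamma>' \<in> ?R (a + b) \<Longrightarrow> c \<gamma>' \<noteq> 0 \<Longrightarrow> ?deg \<gamma>' \<le> ?deg \<gamma>"
    by blast
  have deg_diff: "?deg (\<gamma>' - \<alpha>) + ?deg \<alpha> = ?deg \<gamma>'" if "\<alpha> \<le> \<gamma>'" for \<alpha> \<gamma>'
    unfolding sum.distrib[symmetric] by (rule sum.cong) (use that in \<open>auto simp: le_fun_def\<close>)
  \<comment> \<open>\<open>A\<close> takes as much of the degree as \<open>a\<close> permits; the
    remainder is at most \<open>b\<close> because \<open>\<gamma>\<close> has degree at most
    \<open>a + b\<close>.\<close>
  define a' where "a' = min a (?deg \<gamma>)"
  define b' where "b' = ?deg \<gamma> - a'"
  have ab: "a' \<le> a" "b' \<le> b" "a' + b' = ?deg \<gamma>"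
    using \<gamma>(1) by (auto simp: a'_def b'_def reduced_exponents_def)
  obtain \<alpha> where \<alpha>: "\<alpha> \<le> \<gamma>" "?deg \<alpha> = a'"
    using exists_le_fun_sum_eq[of UNIV a' \<gamma>] ab by auto
  define \<beta> where "\<beta> = \<gamma> - \<alpha>"
  have \<beta>: "?deg \<beta> = b'"
    using deg_diff[OF \<alpha>(1)] \<alpha>(2) ab by (simp add: \<beta>_def)
  have red: "\<alpha>' \<in> ?R (?deg \<alpha>')" "\<gamma>' - \<alpha>' \<in> ?R (?deg (\<gamma>' - \<alpha>'))"
    if "\<alpha>' \<le> \<gamma>'" "\<gamma>' \<in> ?R (a + b)" for \<alpha>' \<gamma>'
    using that by (auto simp: reduced_exponents_def le_fun_def intro: le_less_trans less_imp_diff_less)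
  have "independent_on monomial_eval (?R a') A" "independent_on monomial_eval (?R b') B"
    using independent_on_subset[OF A reduced_exponents_mono[OF ab(1)] finite_reduced_exponents]
      independent_on_subset[OF B reduced_exponents_mono[OF ab(2)] finite_reduced_exponents]
    by simp_all
  from this[THEN independent_on_dual[OF finite_reduced_exponents finite]]
  obtain M N where
    "\<forall>s\<in>?R a'. \<forall>t\<in>?R a'. (\<Sum>x\<in>A. M s x * monomial_eval t x) = (if s = t then 1 else 0)"
    "\<forall>s\<in>?R b'. \<forall>t\<in>?R b'. (\<Sum>y\<in>B. N s y * monomial_eval t y) = (if s = t then 1 else 0)"
    by blast
  moreover have "\<alpha> \<in> ?R a'" "\<beta> \<in> ?R b'"
    using red[OF \<alpha>(1) \<gamma>(1)] \<alpha>(2) \<beta> by (auto simp: \<beta>_def)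
  moreover define \<mu> \<nu> where "\<mu> = M \<alpha>" and "\<nu> = N \<beta>"
  ultimately have
    \<mu>: "\<And>t. t \<in> ?R a' \<Longrightarrow> (\<Sum>x\<in>A. \<mu> x * monomial_eval t x) = (if t = \<alpha> then 1 else 0)" and
    \<nu>: "\<And>t. t \<in> ?R b' \<Longrightarrow> (\<Sum>y\<in>B. \<nu> y * monomial_eval t y) = (if t = \<beta> then 1 else 0)"
    by auto
  define F where "F t = (\<Sum>x\<in>A. \<mu> x * monomial_eval t x)" for t
  define G where "G t = (\<Sum>y\<in>B. \<nu> y * monomial_eval t y)" for t
  define C where "C \<gamma>' \<alpha>' = (of_nat (\<Prod>j\<in>UNIV. \<gamma>' j choose \<alpha>' j) :: 'p mod_ring)"
    for \<gamma>' \<alpha>' :: "'n \<Rightarrow> nat"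
  \<comment> \<open>\<open>F\<close> is known only up to degree \<open>a'\<close> and
    \<open>G\<close> only up to degree \<open>b'\<close>. Since \<open>\<gamma>'\<close> has degree
    at most \<open>a' + b'\<close>, an \<open>\<alpha>'\<close> of degree above \<open>a'\<close>
    leaves degree below \<open>b'\<close>, where \<open>G\<close> vanishes.\<close>
  have FG: "F \<alpha>' * G (\<gamma>' - \<alpha>') = (if \<gamma>' = \<gamma> \<and> \<alpha>' = \<alpha> then 1 else 0)"
    if "\<gamma>' \<in> ?R (a + b)" "c \<gamma>' \<noteq> 0" "\<alpha>' \<le> \<gamma>'" for \<gamma>' \<alpha>'
  proof -
    have deg: "?deg (\<gamma>' - \<alpha>') + ?deg \<alpha>' \<le> a' + b'"
      using deg_diff[OF that(3)] max[OF that(1,2)] ab by simp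
    show ?thesis
    proof (cases "?deg \<alpha>' \<le> a'")
      case True
      then have "\<alpha>' \<in> ?R a'"
        using red(1)[OF that(3,1)] reduced_exponents_mono by blast
      then have F: "F \<alpha>' = (if \<alpha>' = \<alpha> then 1 else 0)"
        by (simp add: F_def \<mu>)
      show ?thesis
      proof (cases "\<alpha>' = \<alpha>")
        case True
        then have "?deg (\<gamma>' - \<alpha>') \<le> b'" using deg \<alpha>(2) by simp
        then have "\<gamma>' - \<alpha>' \<in> ?R b'"
          using red(2)[OF that(3,1)] reduced_exponents_mono by blast
        then have "G (\<gamma>' - \<alpha>') = (if \<gamma>' - \<alpha>' = \<beta> then 1 else 0)"
          by (simp add: G_def \<nu>)
        \<comment> \<open>Subtraction is truncated; it cancels here because \<open>\<alpha>\<close>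
          lies below both \<open>\<gamma>\<close> and \<open>\<gamma>'\<close>.\<close>
        moreover have "\<gamma>' - \<alpha> = \<beta> \<longleftrightarrow> \<gamma>' = \<gamma>"
        proof
          assume eq: "\<gamma>' - \<alpha> = \<beta>"
          show "\<gamma>' = \<gamma>"
          proof
            fix j
            show "\<gamma>' j = \<gamma> j"
              using fun_cong[OF eq, of j] le_funD[OF \<alpha>(1), of j] le_funD[OF that(3), of j] True
              by (simp add: \<beta>_def)
          qed
        qed (simp add: \<beta>_def)
        ultimately show ?thesis using F True by simp
      qed (use F in simp)
    next
      case False
      then have deg': "?deg (\<gamma>' - \<alpha>') < b'" using deg by simp
      then have "\<gamma>' - \<alpha>' \<in> ?R b'"
        using red(2)[OF that(3,1)] reduced_exponents_mono less_imp_le by blast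
      moreover have "\<gamma>' - \<alpha>' \<noteq> \<beta>" using deg' \<beta> by auto
      ultimately have "G (\<gamma>' - \<alpha>') = 0" by (simp add: G_def \<nu>)
      then show ?thesis using False \<alpha>(2) by auto
    qed
  qed
  have swap: "(\<Sum>x\<in>A. \<Sum>y\<in>B. \<Sum>s\<in>S. f x y s) = (\<Sum>s\<in>S. \<Sum>x\<in>A. \<Sum>y\<in>B. f x y s)"
    for f :: "'p mod_ring ^ 'n \<Rightarrow> 'p mod_ring ^ 'n \<Rightarrow> ('n \<Rightarrow> nat) \<Rightarrow> 'p mod_ring" and S
  proof -
    have "(\<Sum>x\<in>A. \<Sum>y\<in>B. \<Sum>s\<in>S. f x y s) = (\<Sum>x\<in>A. \<Sum>s\<in>S. \<Sum>y\<in>B. f x y s)"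
      by (intro sum.cong refl sum.swap)
    also have "\<dots> = (\<Sum>s\<in>S. \<Sum>x\<in>A. \<Sum>y\<in>B. f x y s)"
      by (rule sum.swap)
    finally show ?thesis .
  qed
  \<comment> \<open>The product functional is applied to the polynomial at \<open>x + y\<close>: the
    result is zero by vanishing on \<open>A + B\<close>, and the expansion leaves only the term of
    \<open>\<gamma>\<close> and \<open>\<alpha>\<close>.\<close>
  have "0 = (\<Sum>x\<in>A. \<Sum>y\<in>B. \<mu> x * \<nu> y * (\<Sum>\<gamma>'\<in>?R (a + b). c \<gamma>' * monomial_eval \<gamma>' (x + y)))"
    using c by (intro sum.neutral[symmetric] ballI) (simp add: set_plus_intro)
  also have "\<dots> = (\<Sum>x\<in>A. \<Sum>y\<in>B. \<Sum>\<gamma>'\<in>?R (a + b). \<Sum>\<alpha>'\<le>\<gamma>'.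
      c \<gamma>' * C \<gamma>' \<alpha>' * ((\<mu> x * monomial_eval \<alpha>' x) * (\<nu> y * monomial_eval (\<gamma>' - \<alpha>') y)))"
    by (simp add: monomial_eval_add C_def sum_distrib_left algebra_simps)
  also have "\<dots> = (\<Sum>\<gamma>'\<in>?R (a + b). \<Sum>\<alpha>'\<le>\<gamma>'. \<Sum>x\<in>A. \<Sum>y\<in>B.
      c \<gamma>' * C \<gamma>' \<alpha>' * ((\<mu> x * monomial_eval \<alpha>' x) * (\<nu> y * monomial_eval (\<gamma>' - \<alpha>') y)))"
    by (simp only: swap)
  also have "\<dots> = (\<Sum>\<gamma>'\<in>?R (a + b). \<Sum>\<alpha>'\<le>\<gamma>'. c \<gamma>' * C \<gamma>' \<alpha>' * (F \<alpha>' * G (\<gamma>' - \<alpha>')))"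
    unfolding F_def G_def sum_product by (simp only: sum_distrib_left)
  also have "\<dots> = (\<Sum>\<gamma>'\<in>?R (a + b). \<Sum>\<alpha>'\<le>\<gamma>'.
      if \<alpha>' = \<alpha> then (if \<gamma>' = \<gamma> then c \<gamma>' * C \<gamma>' \<alpha>' else 0) else 0)"
  proof (intro sum.cong refl)
    fix \<gamma>' \<alpha>' assume "\<gamma>' \<in> ?R (a + b)" "\<alpha>' \<in> {..\<gamma>'}"
    then show "c \<gamma>' * C \<gamma>' \<alpha>' * (F \<alpha>' * G (\<gamma>' - \<alpha>')) =
        (if \<alpha>' = \<alpha> then (if \<gamma>' = \<gamma> then c \<gamma>' * C \<gamma>' \<alpha>' else 0) else 0)"
      \<comment> \<open>The case split is there because \<open>FG\<close> bounds the degree of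
        \<open>\<gamma>'\<close> only when its coefficient is nonzero.\<close>
      using FG[of \<gamma>' \<alpha>'] by (cases "c \<gamma>' = 0") auto
  qed
  also have "\<dots> = (\<Sum>\<gamma>'\<in>?R (a + b). if \<gamma>' = \<gamma> then c \<gamma> * C \<gamma> \<alpha> else 0)"
    by (rule sum.cong) (use \<alpha>(1) in \<open>auto simp: finite_atMost_fun\<close>)
  also have "\<dots> = c \<gamma> * C \<gamma> \<alpha>"
    using \<gamma>(1) by (simp add: finite_reduced_exponents)
  finally have "C \<gamma> \<alpha> = 0" using \<gamma>(2) by simp
  moreover have "C \<gamma> \<alpha> \<noteq> 0"
    unfolding C_def using \<alpha>(1) \<gamma>(1)
    by (intro of_nat_prod_choose_neq_0) (auto simp: reduced_exponents_def)
  ultimately show False by contradiction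
qed

section \<open>Formal polynomials, iterated sumsets and the monomial count\<close>

lemma monomial_degree_eq_sum:
  "finite J \<Longrightarrow> Poly_Mapping.keys \<alpha> \<subseteq> J \<Longrightarrow>
     monomial_degree \<alpha> = (\<Sum>j\<in>J. Poly_Mapping.lookup \<alpha> j)"
  unfolding monomial_degree_def
  by (intro sum.mono_neutral_left) (auto simp: in_keys_iff)

text \<open>The coefficients of a nontrivial relation on \<open>A\<close> define a polynomial that
  is formally nonzero and vanishes on \<open>A\<close>.\<close>

lemma independent_on_if_not_subset_zero_set:
  fixes A :: "('a::comm_semiring_1 ^ 'n) set"
  assumes "\<not> (\<exists>P :: ('n, 'a) mpoly. P \<noteq> 0 \<and> total_degree P \<le> d \<and> A \<subseteq> zero_set P)"
  shows "independent_on monomial_eval (reduced_exponents q d) A"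
  unfolding independent_on_def
proof (intro allI impI ballI, rule ccontr)
  let ?R = "reduced_exponents q d :: ('n \<Rightarrow> nat) set"
  fix c \<gamma>
  assume c: "\<forall>x\<in>A. (\<Sum>\<alpha>\<in>?R. c \<alpha> * monomial_eval \<alpha> x) = (0::'a)"
    and \<gamma>: "\<gamma> \<in> ?R" "c \<gamma> \<noteq> 0"
  \<comment> \<open>The variable type is finite, so every exponent function has finite
    support.\<close>
  have lookup_Abs: "Poly_Mapping.lookup (Abs_poly_mapping \<alpha>) = \<alpha>" for \<alpha> :: "'n \<Rightarrow> nat"
    by (simp add: Abs_poly_mapping_inverse)
  have inj: "inj_on Abs_poly_mapping ?R"
    by (metis inj_onI lookup_Abs)
  define S where "S = Abs_poly_mapping ` ?R"
  have S: "finite S"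
    by (simp add: S_def finite_reduced_exponents)
  define P :: "('n, 'a) mpoly" where
    "P = Abs_poly_mapping (\<lambda>\<alpha>. if \<alpha> \<in> S then c (Poly_Mapping.lookup \<alpha>) else 0)"
  have P: "Poly_Mapping.lookup P \<alpha> = (if \<alpha> \<in> S then c (Poly_Mapping.lookup \<alpha>) else 0)" for \<alpha>
    unfolding P_def by (subst Abs_poly_mapping_inverse) (auto intro: finite_subset[OF _ S])
  have keys: "Poly_Mapping.keys P \<subseteq> S"
    by (auto simp: in_keys_iff P split: if_splits)
  have "Poly_Mapping.lookup P (Abs_poly_mapping \<gamma>) \<noteq> 0"
    using \<gamma> by (auto simp: P S_def lookup_Abs)
  then have "P \<noteq> 0" by auto
  moreover have "total_degree P \<le> d"
  proof -
    have "monomial_degree \<alpha> \<le> d" if "\<alpha> \<in> S" for \<alpha>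
      using that by (auto simp: S_def monomial_degree_eq_sum[of UNIV] lookup_Abs reduced_exponents_def)
    then show ?thesis
      using keys by (auto simp: total_degree_def)
  qed
  moreover have "A \<subseteq> zero_set P"
  proof
    fix x assume x: "x \<in> A"
    have "mpoly_eval P x =
        (\<Sum>\<alpha>\<in>S. Poly_Mapping.lookup P \<alpha> * monomial_eval (Poly_Mapping.lookup \<alpha>) x)"
      unfolding mpoly_eval_def monomial_eval_def
      by (rule sum.mono_neutral_left[OF S keys]) (auto simp: in_keys_iff)
    also have "\<dots> = (\<Sum>\<alpha>\<in>?R. c \<alpha> * monomial_eval \<alpha> x)"
      unfolding S_def by (subst sum.reindex[OF inj]) (auto simp: P S_def lookup_Abs intro!: sum.cong)
    finally show "x \<in> zero_set P" using c x by (simp add: zero_set_def)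
  qed
  ultimately show False using assms by blast
qed

lemma independent_on_sum_sets:
  fixes A :: "nat \<Rightarrow> ('p::prime_card mod_ring ^ 'n) set"
  assumes "finite I"
    and "\<And>i. i \<in> I \<Longrightarrow> independent_on monomial_eval (reduced_exponents CARD('p) (k i)) (A i)"
  shows "independent_on monomial_eval (reduced_exponents CARD('p) (\<Sum>i\<in>I. k i)) (\<Sum>i\<in>I. A i)"
  using assms
proof (induction I rule: finite_induct)
  case empty
  \<comment> \<open>The empty sum of sets is \<open>{0}\<close>; the only exponent of degree 0 gives
    the constant 1, which is independent there.\<close>
  have "reduced_exponents CARD('p) 0 = {\<lambda>_ :: 'n. 0}"
    by (auto simp: reduced_exponents_def prime_card prime_gt_0_nat)
  then show ?case
    by (simp add: independent_on_def monomial_eval_def)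
next
  case (insert i I)
  then show ?case
    by (simp add: independent_on_sumset)
qed

text \<open>A bijection from the index type to \<open>{1..n}\<close>, with \<open>n\<close> its
  cardinality, carries exponents over and preserves degrees; an injection suffices for the
  bound.\<close>

lemma num_monomials_le_card_reduced_exponents:
  assumes "q > 0"
  shows "num_monomials q CARD('n) D \<le> card (reduced_exponents q D :: ('n::finite \<Rightarrow> nat) set)"
proof -
  obtain h :: "'n \<Rightarrow> nat" where h: "bij_betw h UNIV {1..CARD('n)}"
    using finite_same_card_bij[of "UNIV :: 'n set" "{1..CARD('n)}"] by auto
  let ?T = "{\<alpha> :: nat monomial. Poly_Mapping.keys \<alpha> \<subseteq> {1..CARD('n)} \<and> monomial_degree \<alpha> \<le> D \<and>
       (\<forall>j\<in>{1..CARD('n)}. Poly_Mapping.lookup \<alpha> j \<le> q - 1)}"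
  let ?f = "\<lambda>\<alpha> :: nat monomial. Poly_Mapping.lookup \<alpha> \<circ> h"
  have hj: "h j \<in> {1..CARD('n)}" for j
    using h bij_betwE by blast
  have "inj_on ?f ?T"
  proof (rule inj_onI, rule poly_mapping_eqI)
    fix \<alpha> \<beta> i
    assume \<alpha>\<beta>: "\<alpha> \<in> ?T" "\<beta> \<in> ?T" "?f \<alpha> = ?f \<beta>"
    show "Poly_Mapping.lookup \<alpha> i = Poly_Mapping.lookup \<beta> i"
    proof (cases "i \<in> {1..CARD('n)}")
      case True
      then obtain j where "i = h j"
        using h by (metis bij_betw_imp_surj_on imageE)
      then show ?thesis using fun_cong[OF \<alpha>\<beta>(3), of j] by simp
    next
      case False
      then have "i \<notin> Poly_Mapping.keys \<alpha>" "i \<notin> Poly_Mapping.keys \<beta>"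
        using \<alpha>\<beta> by blast+
      then show ?thesis by (simp add: in_keys_iff)
    qed
  qed
  moreover have "?f ` ?T \<subseteq> reduced_exponents q D"
  proof
    fix \<gamma> assume "\<gamma> \<in> ?f ` ?T"
    then obtain \<alpha> where \<alpha>: "\<alpha> \<in> ?T" "\<gamma> = ?f \<alpha>" by blast
    have "(\<Sum>j\<in>UNIV. \<gamma> j) = monomial_degree \<alpha>"
      using \<alpha> sum.reindex_bij_betw[OF h, of "Poly_Mapping.lookup \<alpha>"]
      by (simp add: monomial_degree_eq_sum[of "{1..CARD('n)}"])
    moreover have "\<gamma> j < q" for j
    proof -
      have "\<gamma> j \<le> q - 1" using \<alpha> hj[of j] by simp
      then show ?thesis using assms by simp
    qed
    ultimately show "\<gamma> \<in> reduced_exponents q D"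
      using \<alpha>(1) by (simp add: reduced_exponents_def)
  qed
  ultimately show ?thesis
    unfolding num_monomials_def by (rule card_inj_on_le[OF _ _ finite_reduced_exponents])
qed

theorem theorem1p5:
  fixes D m :: nat
    and k :: "nat \<Rightarrow> nat"
    and A :: "nat \<Rightarrow> ('p::prime_card mod_ring ^ 'n) set"
  assumes "m > 0"
    and "\<forall>i\<in>{1..m}. k i > 0"
    and "(\<Sum>i=1..m. k i) \<ge> D"
    and "\<forall>i\<in>{1..m}. \<not> (\<exists>P :: ('n, 'p mod_ring) mpoly.
           P \<noteq> 0 \<and> total_degree P \<le> k i \<and> A i \<subseteq> zero_set P)"
  shows "card (\<Sum>i=1..m. A i) \<ge> num_monomials CARD('p) CARD('n) D"
proof -
  have "independent_on monomial_eval (reduced_exponents CARD('p) (\<Sum>i=1..m. k i)) (\<Sum>i=1..m. A i)"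
    using assms(4) by (intro independent_on_sum_sets independent_on_if_not_subset_zero_set) auto
  \<comment> \<open>Only the exponents of degree at most \<open>D\<close> are counted, so the larger
    family is cut down to them.\<close>
  then have "independent_on monomial_eval (reduced_exponents CARD('p) D) (\<Sum>i=1..m. A i)"
    by (rule independent_on_subset[OF _ reduced_exponents_mono[OF assms(3)] finite_reduced_exponents])
  then have "card (reduced_exponents CARD('p) D :: ('n \<Rightarrow> nat) set) \<le> card (\<Sum>i=1..m. A i)"
    by (intro independent_on_card_le finite_reduced_exponents finite)
  moreover have "CARD('p) > 0" by simp
  ultimately show ?thesis
    using num_monomials_le_card_reduced_exponents[where 'n='n] le_trans by blast
qed

end
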